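(* Let $G$ be a graph with $n$ vertices, let $F=\sum_{i=1}^n d_i^3$ and let $\rho_1$ be the largest eigenvalue of the Sombor matrix $\mathcal{S}(G)$. Then $$2\rho_1\leq \mathcal{E}(G)\leq \rho_1+\sqrt{(n-1)(2F-\rho_1^2)}.$$
   Context: $G$ is a simple undirected graph on vertices $v_1,\dots,v_n$ with degrees $d_i$. The Sombor matrix $\mathcal{S}(G)$ has $(i,j)$-entry $\sqrt{d_i^2+d_j^2}$ if $v_i,v_j$ are adjacent and $0$ otherwise, with eigenvalues $\rho_1\ge\cdots\ge\rho_n$. The Sombor energy is $\mathcal{E}(G)=\sum_{i=1}^n|\rho_i|$. *)

theory Defs
  imports "Jordan_Normal_Form.Char_Poly" "Graph_Theory.Digraph"
    "HOL-Computational_Algebra.Fundamental_Theorem_Algebra"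
begin

text \<open>
  A finite simple undirected graph is the locale \<open>graph\<close>: a finite, loop-free, symmetric
  digraph without parallel arcs.  An edge is then a pair of opposite arcs, so the degree of a
  vertex is its out-degree.  The vertices are labelled \<open>v 0, \<dots>, v (n - 1)\<close>,
  matching the indexing of matrix rows and columns.
\<close>

definition sombor_matrix :: "('a, 'b) pre_digraph \<Rightarrow> nat \<Rightarrow> (nat \<Rightarrow> 'a) \<Rightarrow> real mat" where
  "sombor_matrix G n v = mat n n (\<lambda>(i, j).
     if v i \<rightarrow>\<^bsub>G\<^esub> v j
     then sqrt ((real (out_degree G (v i)))\<^sup>2 + (real (out_degree G (v j)))\<^sup>2)
     else 0)"

text \<open>
  The real eigenvalues, repeated according to their multiplicity as roots of the characteristic
  polynomial, in non-increasing order.  For a symmetric matrix no eigenvalue is lost by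
  restricting to real roots: see \<open>length_eigenvalues\<close> below.
\<close>

definition eigenvalues :: "real mat \<Rightarrow> real list" where
  "eigenvalues A = rev (sorted_list_of_multiset (proots (char_poly A)))"

definition sombor_energy :: "('a, 'b) pre_digraph \<Rightarrow> nat \<Rightarrow> (nat \<Rightarrow> 'a) \<Rightarrow> real" where
  "sombor_energy G n v = (\<Sum>i<n. \<bar>eigenvalues (sombor_matrix G n v) ! i\<bar>)"

lemma symmetric_eigenvalue_real:
  fixes A :: "real mat"
  assumes A: "A \<in> carrier_mat n n" and sym: "transpose_mat A = A"
    and ev: "eigenvalue (map_mat complex_of_real A) a"
  shows "a \<in> \<real>"
proof -
  let ?B = "map_mat complex_of_real A"
  have B: "?B \<in> carrier_mat n n" using A by simp
  have Bs: "?B $$ (i, j) = ?B $$ (j, i)" if "i < n" "j < n" for i j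
    using that A arg_cong[OF sym, of "\<lambda>M. M $$ (i, j)"] by simp
  obtain x where x: "x \<in> carrier_vec n" "x \<noteq> 0\<^sub>v n" and eq: "?B *\<^sub>v x = a \<cdot>\<^sub>v x"
    using ev A by (auto simp: eigenvalue_def eigenvector_def)
  have row: "(\<Sum>j<n. ?B $$ (i, j) * x $ j) = a * x $ i" if "i < n" for i
  proof -
    have "(?B *\<^sub>v x) $ i = (\<Sum>j<n. ?B $$ (i, j) * x $ j)"
      using that A x by (simp add: scalar_prod_def atLeast0LessThan)
    then show ?thesis using eq that x by simp
  qed
  have rowc: "(\<Sum>j<n. ?B $$ (i, j) * cnj (x $ j)) = cnj a * cnj (x $ i)" if "i < n" for i
  proof -
    have "cnj (\<Sum>j<n. ?B $$ (i, j) * x $ j) = (\<Sum>j<n. ?B $$ (i, j) * cnj (x $ j))"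
      unfolding cnj_sum using A that by (intro sum.cong) auto
    then show ?thesis using row[OF that] by simp
  qed
  let ?N = "\<Sum>i<n. x $ i * cnj (x $ i)"
  have "a * ?N = (\<Sum>i<n. (\<Sum>j<n. ?B $$ (i, j) * x $ j) * cnj (x $ i))"
    by (simp add: row sum_distrib_left mult.assoc)
  also have "\<dots> = (\<Sum>i<n. \<Sum>j<n. ?B $$ (i, j) * x $ j * cnj (x $ i))"
    by (simp add: sum_distrib_right)
  also have "\<dots> = (\<Sum>j<n. \<Sum>i<n. ?B $$ (i, j) * x $ j * cnj (x $ i))"
    by (rule sum.swap)
  also have "\<dots> = (\<Sum>j<n. x $ j * (\<Sum>i<n. ?B $$ (j, i) * cnj (x $ i)))"
    unfolding sum_distrib_left
    by (intro sum.cong refl) (use Bs in \<open>simp add: mult_ac\<close>)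
  also have "\<dots> = (\<Sum>j<n. x $ j * (cnj a * cnj (x $ j)))"
    by (intro sum.cong refl) (metis rowc lessThan_iff)
  also have "\<dots> = cnj a * ?N"
    by (simp add: sum_distrib_left mult_ac)
  finally have eqN: "a * ?N = cnj a * ?N" .
  have "?N = x \<bullet>c x"
    using x by (simp add: scalar_prod_def atLeast0LessThan)
  then have "?N \<noteq> 0"
    using x conjugate_square_eq_0_vec[OF x(1)] by simp
  then show ?thesis using eqN by (simp add: Reals_cnj_iff)
qed

lemma symmetric_char_poly_splits:
  fixes A :: "real mat"
  assumes A: "A \<in> carrier_mat n n" and sym: "transpose_mat A = A"
  shows "\<exists>rs. length rs = n \<and> char_poly A = (\<Prod>r\<leftarrow>rs. [:- r, 1:])"
proof -
  let ?B = "map_mat complex_of_real A"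
  have B: "?B \<in> carrier_mat n n" using A by simp
  obtain as where as: "char_poly ?B = (\<Prod>a\<leftarrow>as. [:- a, 1:])" "length as = n"
    using char_poly_factorized[OF B] by blast
  have "a \<in> \<real>" if "a \<in> set as" for a
  proof -
    have "poly (char_poly ?B) a = 0"
      using that by (auto simp: as poly_prod_list prod_list_zero_iff)
    then show ?thesis
      using symmetric_eigenvalue_real[OF A sym] eigenvalue_root_char_poly[OF B] by blast
  qed
  then have asr: "as = map complex_of_real (map Re as)"
    by (auto simp: map_idI)
  interpret h: map_poly_inj_comm_ring_hom complex_of_real ..
  have *: "(\<Prod>a\<leftarrow>map complex_of_real rs. [:- a, 1:]) =
      map_poly complex_of_real (\<Prod>r\<leftarrow>rs. [:- r, 1:])" for rs
    by (induction rs) (simp_all add: hom_distribs)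
  have "map_poly complex_of_real (char_poly A) = char_poly ?B"
    by (rule of_real_hom.char_poly_hom[OF A, symmetric])
  also have "\<dots> = map_poly complex_of_real (\<Prod>r\<leftarrow>map Re as. [:- r, 1:])"
    unfolding as(1) *[symmetric] using asr by simp
  finally have "char_poly A = (\<Prod>r\<leftarrow>map Re as. [:- r, 1:])"
    by simp
  then show ?thesis using as(2) by (intro exI[of _ "map Re as"]) simp
qed

lemma length_eigenvalues:
  fixes A :: "real mat"
  assumes "A \<in> carrier_mat n n" and "transpose_mat A = A"
  shows "length (eigenvalues A) = n"
proof -
  obtain rs where rs: "length rs = n" "char_poly A = (\<Prod>r\<leftarrow>rs. [:- r, 1:])"
    using symmetric_char_poly_splits[OF assms] by blast
  have nz: "(\<Prod>r\<leftarrow>rs. [:- r, 1:]) \<noteq> 0" for rs :: "real list"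
    by (auto simp: prod_list_zero_iff)
  have "proots (\<Prod>r\<leftarrow>rs. [:- r, 1:]) = mset rs" for rs :: "real list"
    by (induction rs) (use nz in \<open>simp_all add: proots_mult del: mult_pCons_left\<close>)
  then have "mset (eigenvalues A) = mset rs"
    by (simp add: eigenvalues_def rs)
  then show ?thesis using rs(1) by (metis size_mset)
qed

lemma sombor_matrix_carrier: "sombor_matrix G n v \<in> carrier_mat n n"
  by (simp add: sombor_matrix_def)

lemma sombor_matrix_symmetric:
  assumes "graph G"
  shows "transpose_mat (sombor_matrix G n v) = sombor_matrix G n v"
proof -
  interpret graph G by fact
  have "v i \<rightarrow>\<^bsub>G\<^esub> v j \<longleftrightarrow> v j \<rightarrow>\<^bsub>G\<^esub> v i" for i j
    using sym_arcs by (auto simp: symmetric_def sym_def)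
  then show ?thesis
    by (intro eq_matI) (auto simp: sombor_matrix_def add.commute)
qed

end

theory Submission
  imports Defs "Jordan_Normal_Form.Schur_Decomposition" "HOL-Analysis.L2_Norm"
begin

text \<open>
  Triangularizing the Sombor matrix \<open>S\<close> over the reals gives
  \<open>\<Sum> \<rho>\<^sub>i = tr S = 0\<close> and \<open>\<Sum> \<rho>\<^sub>i\<^sup>2 = tr (S\<^sup>2) = 2 F\<close>; the last equality holds because each ordered
  pair of adjacent vertices contributes \<open>d\<^sub>i\<^sup>2 + d\<^sub>j\<^sup>2\<close> and every vertex occurs in \<open>d\<^sub>i\<close> pairs on
  either side.  The lower bound is then the triangle inequality for
  \<open>\<rho>\<^sub>1 = - (\<rho>\<^sub>2 + \<dots> + \<rho>\<^sub>n)\<close>, and the upper bound is the Cauchy--Schwarz inequality for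
  \<open>\<bar>\<rho>\<^sub>2\<bar> + \<dots> + \<bar>\<rho>\<^sub>n\<bar>\<close>.
\<close>

definition mat_trace :: "'a :: comm_monoid_add mat \<Rightarrow> 'a" where
  "mat_trace A = (\<Sum>i<dim_row A. A $$ (i, i))"

lemma mat_trace_mult:
  fixes A B :: "'a :: semiring_0 mat"
  assumes "A \<in> carrier_mat n m" "B \<in> carrier_mat m n"
  shows "mat_trace (A * B) = (\<Sum>i<n. \<Sum>j<m. A $$ (i, j) * B $$ (j, i))"
  using assms by (auto simp: mat_trace_def scalar_prod_def atLeast0LessThan intro!: sum.cong)

lemma mat_trace_mult_commute:
  fixes A B :: "'a :: comm_semiring_0 mat"
  assumes "A \<in> carrier_mat n m" "B \<in> carrier_mat m n"
  shows "mat_trace (A * B) = mat_trace (B * A)"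
  unfolding mat_trace_mult[OF assms] mat_trace_mult[OF assms(2,1)]
  by (subst sum.swap) (simp add: mult.commute)

lemma mat_trace_similar:
  fixes A B :: "'a :: comm_semiring_1 mat"
  assumes "similar_mat A B"
  shows "mat_trace A = mat_trace B"
proof -
  obtain n P Q where carr: "B \<in> carrier_mat n n" "P \<in> carrier_mat n n" "Q \<in> carrier_mat n n"
    and QP: "Q * P = 1\<^sub>m n" and A: "A = P * B * Q"
    using similar_matD[OF assms] by auto
  have "mat_trace A = mat_trace (Q * (P * B))"
    unfolding A using carr by (intro mat_trace_mult_commute) auto
  also have "Q * (P * B) = Q * P * B"
    using carr by simp
  finally show ?thesis using QP carr by simp
qed

text \<open>For distinct \<open>i\<close> and \<open>j\<close>, one of the positions
  \<open>(i, j)\<close> and \<open>(j, i)\<close> lies below the diagonal, so only the term with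
  \<open>j = i\<close> survives.\<close>

lemma mat_trace_square_upper_triangular:
  fixes B :: "'a :: semiring_1 mat"
  assumes B: "B \<in> carrier_mat n n" and ut: "upper_triangular B"
  shows "mat_trace (B * B) = (\<Sum>i<n. (B $$ (i, i))\<^sup>2)"
  unfolding mat_trace_mult[OF B B]
proof (intro sum.cong refl)
  fix i assume i: "i \<in> {..<n}"
  have "B $$ (i, j) * B $$ (j, i) = 0" if "j < n" "j \<noteq> i" for j
    using that i B ut by (cases j i rule: linorder_cases) (auto simp: upper_triangular_def)
  then have "(\<Sum>j<n. B $$ (i, j) * B $$ (j, i)) = (\<Sum>j\<in>{i}. B $$ (i, j) * B $$ (j, i))"
    using i by (intro sum.mono_neutral_right) auto
  then show "(\<Sum>j<n. B $$ (i, j) * B $$ (j, i)) = (B $$ (i, i))\<^sup>2"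
    by (simp add: power2_eq_square)
qed

lemma similar_mat_square:
  fixes A B :: "'a :: semiring_1 mat"
  assumes "similar_mat A B"
  shows "similar_mat (A * A) (B * B)"
proof -
  obtain P Q where wit: "similar_mat_wit A B P Q"
    using assms by (auto simp: similar_mat_def)
  define n where "n = dim_row A"
  have "A \<in> carrier_mat n n" "B \<in> carrier_mat n n"
    using similar_mat_witD[OF n_def wit] by blast+
  then have "A ^\<^sub>m 2 = A * A" "B ^\<^sub>m 2 = B * B"
    by (simp_all add: numeral_2_eq_2)
  then show ?thesis
    using similar_mat_wit_pow[OF wit, of 2] unfolding similar_mat_def by metis
qed

text \<open>Schur decomposition needs a complete real factorization listed by the roots that are to
  appear on the diagonal. Any such factorization has the roots of \<open>eigenvalues A\<close> with
  multiplicity, and the order is immaterial to the product.\<close>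

lemma char_poly_eigenvalues:
  fixes A :: "real mat"
  assumes "A \<in> carrier_mat n n" and "transpose_mat A = A"
  shows "char_poly A = (\<Prod>r\<leftarrow>eigenvalues A. [:- r, 1:])"
proof -
  obtain rs where rs: "char_poly A = (\<Prod>r\<leftarrow>rs. [:- r, 1:])"
    using symmetric_char_poly_splits[OF assms] by blast
  have nz: "(\<Prod>r\<leftarrow>rs. [:- r, 1:]) \<noteq> 0" for rs :: "real list"
    by (auto simp: prod_list_zero_iff)
  have "proots (\<Prod>r\<leftarrow>rs. [:- r, 1:]) = mset rs" for rs :: "real list"
    by (induction rs) (use nz in \<open>simp_all add: proots_mult del: mult_pCons_left\<close>)
  then have "mset (eigenvalues A) = mset rs"
    by (simp add: eigenvalues_def rs)
  then have "mset (map (\<lambda>r. [:- r, 1:]) (eigenvalues A)) = mset (map (\<lambda>r. [:- r, 1:]) rs)"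
    by simp
  then show ?thesis
    unfolding rs by (metis prod_mset_prod_list)
qed

lemma sum_eigenvalues:
  fixes A :: "real mat"
  assumes A: "A \<in> carrier_mat n n" and sym: "transpose_mat A = A"
  shows "(\<Sum>i<n. eigenvalues A ! i) = mat_trace A"
    and "(\<Sum>i<n. (eigenvalues A ! i)\<^sup>2) = mat_trace (A * A)"
proof -
  \<comment> \<open>The triangular form carries the supplied list on its diagonal in the given
    order, so the sums below match term by term.\<close>
  obtain B P Q where "schur_decomposition A (eigenvalues A) = (B, P, Q)"
    by (metis prod_cases3)
  note schur = schur_decomposition[OF A char_poly_eigenvalues[OF assms] this]
  then have sim: "similar_mat A B" and ut: "upper_triangular B"
    and diag: "diag_mat B = eigenvalues A"
    by (auto simp: similar_mat_def)
  have B: "B \<in> carrier_mat n n"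
    using similar_mat_witD2[OF A] schur by blast
  have nth: "eigenvalues A ! i = B $$ (i, i)" if "i < n" for i
    using that B by (simp flip: diag add: diag_mat_def)
  show "(\<Sum>i<n. eigenvalues A ! i) = mat_trace A"
    unfolding mat_trace_similar[OF sim] using B nth by (simp add: mat_trace_def)
  show "(\<Sum>i<n. (eigenvalues A ! i)\<^sup>2) = mat_trace (A * A)"
    unfolding mat_trace_similar[OF similar_mat_square[OF sim]]
      mat_trace_square_upper_triangular[OF B ut]
    using nth by simp
qed

lemma eigenvalues_nth_le_hd:
  assumes "i < length (eigenvalues A)"
  shows "eigenvalues A ! i \<le> eigenvalues A ! 0"
proof -
  have "sorted_wrt (\<ge>) (eigenvalues A)"
    unfolding eigenvalues_def sorted_wrt_rev by simp
  then show ?thesis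
    using assms by (cases "i = 0") (auto simp: sorted_wrt_iff_nth_less)
qed

text \<open>The out-degree counts arcs, while sums over matrix entries count labels. Both sets
  biject with the neighbours of \<open>u\<close>: arcs through their heads, as there are no parallel
  arcs, and labels through \<open>v\<close>.\<close>

lemma (in graph) card_neighbours:
  assumes bij: "bij_betw v {..<n} (verts G)"
  shows "card {j. j < n \<and> u \<rightarrow> v j} = out_degree G u"
proof -
  have arcs: "bij_betw (head G) (out_arcs G u) {w. u \<rightarrow> w}"
    by (auto simp: bij_betw_def inj_on_def arcs_ends_conv arc_to_ends_def intro!: no_multi_arcs)
  have labels: "bij_betw v {j. j < n \<and> u \<rightarrow> v j} {w. u \<rightarrow> w}"
  proof -
    have "{w. u \<rightarrow> w} = v ` {j. j < n \<and> u \<rightarrow> v j}"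
      using bij by (auto simp: bij_betw_def dest: adj_in_verts)
    then show ?thesis
      using bij by (auto simp: bij_betw_def inj_on_def)
  qed
  show ?thesis
    unfolding out_degree_def bij_betw_same_card[OF arcs] bij_betw_same_card[OF labels] ..
qed

lemma mat_trace_sombor_matrix:
  assumes "graph G"
  shows "mat_trace (sombor_matrix G n v) = 0"
proof -
  interpret graph G by fact
  have "\<not> u \<rightarrow>\<^bsub>G\<^esub> u" for u
    using adj_not_same by blast
  then show ?thesis
    by (simp add: mat_trace_def sombor_matrix_def)
qed

lemma mat_trace_sombor_matrix_square:
  assumes "graph G" and bij: "bij_betw v {..<n} (verts G)"
  shows "mat_trace (sombor_matrix G n v * sombor_matrix G n v) =
    2 * (\<Sum>i<n. real (out_degree G (v i)) ^ 3)"
proof -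
  interpret graph G by fact
  let ?d = "\<lambda>i. real (out_degree G (v i))"
  let ?adj = "\<lambda>i j. v i \<rightarrow>\<^bsub>G\<^esub> v j"
  have adj_sym: "?adj i j \<longleftrightarrow> ?adj j i" for i j
    using sym_arcs by (auto simp: symmetric_def sym_def)
  \<comment> \<open>Vertex \<open>v i\<close> has \<open>?d i\<close> neighbours, each contributing
    the same square.\<close>
  have row: "(\<Sum>j<n. if ?adj i j then (?d i)\<^sup>2 else 0) = ?d i ^ 3" for i
  proof -
    have "(\<Sum>j<n. if ?adj i j then (?d i)\<^sup>2 else 0) = (\<Sum>j | j < n \<and> ?adj i j. (?d i)\<^sup>2)"
      by (rule sum.mono_neutral_cong_right) auto
    then show ?thesis
      by (simp add: card_neighbours[OF bij] power3_eq_cube power2_eq_square)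
  qed
  \<comment> \<open>By symmetry, the entries at \<open>(i, j)\<close> and \<open>(j, i)\<close> are
    the same square root, so their product removes it.\<close>
  have "mat_trace (sombor_matrix G n v * sombor_matrix G n v) =
      (\<Sum>i<n. \<Sum>j<n. (if ?adj i j then (?d i)\<^sup>2 else 0) + (if ?adj i j then (?d j)\<^sup>2 else 0))"
    unfolding mat_trace_mult[OF sombor_matrix_carrier sombor_matrix_carrier]
    by (intro sum.cong refl) (auto simp: sombor_matrix_def adj_sym add.commute)
  also have "\<dots> = (\<Sum>i<n. ?d i ^ 3) + (\<Sum>i<n. \<Sum>j<n. if ?adj i j then (?d j)\<^sup>2 else 0)"
    by (simp add: sum.distrib row)
  \<comment> \<open>Exchanging the sums and reversing each adjacency makes \<open>row\<close> apply
    to the second half as well.\<close>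
  also have "(\<Sum>i<n. \<Sum>j<n. if ?adj i j then (?d j)\<^sup>2 else 0) =
      (\<Sum>j<n. \<Sum>i<n. if ?adj j i then (?d j)\<^sup>2 else 0)"
    by (subst sum.swap) (simp add: adj_sym)
  finally show ?thesis
    by (simp add: row)
qed

theorem theorem4p3:
  fixes G :: "('a, 'b) pre_digraph" and n :: nat and v :: "nat \<Rightarrow> 'a"
  assumes "graph G" and "n \<ge> 1" and "bij_betw v {..<n} (verts G)"
  shows "let F = (\<Sum>i<n. real (out_degree G (v i)) ^ 3);
             \<rho>\<^sub>1 = eigenvalues (sombor_matrix G n v) ! 0
         in 2 * \<rho>\<^sub>1 \<le> sombor_energy G n v \<and>
            sombor_energy G n v \<le> \<rho>\<^sub>1 + sqrt ((real n - 1) * (2 * F - \<rho>\<^sub>1\<^sup>2))"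
proof -
  define F where "F = (\<Sum>i<n. real (out_degree G (v i)) ^ 3)"
  define \<rho> where "\<rho> i = eigenvalues (sombor_matrix G n v) ! i" for i
  note S = sombor_matrix_carrier[of G n v] sombor_matrix_symmetric[OF assms(1), of n v]
  have sum: "(\<Sum>i<n. \<rho> i) = 0" and sum_sq: "(\<Sum>i<n. (\<rho> i)\<^sup>2) = 2 * F"
    using sum_eigenvalues[OF S] mat_trace_sombor_matrix[OF assms(1)]
      mat_trace_sombor_matrix_square[OF assms(1,3)]
    by (simp_all add: \<rho>_def F_def)
  have le: "\<rho> i \<le> \<rho> 0" if "i < n" for i
    using eigenvalues_nth_le_hd length_eigenvalues[OF S] that by (simp add: \<rho>_def)
  \<comment> \<open>The largest eigenvalue is at least the average, which is zero. Its sign lets the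
    absolute value be dropped from the first term of the energy.\<close>
  have "(\<Sum>i<n. \<rho> i) \<le> real n * \<rho> 0"
    using sum_bounded_above[of "{..<n}" \<rho> "\<rho> 0"] le by simp
  then have \<rho>0: "\<rho> 0 \<ge> 0"
    using sum assms(2) by (simp add: zero_le_mult_iff)
  have split: "(\<Sum>i<n. f i) = f 0 + (\<Sum>i\<in>{1..<n}. f i)" for f :: "nat \<Rightarrow> real"
    using assms(2) by (simp add: sum.atLeast_Suc_lessThan flip: atLeast0LessThan)
  have energy: "sombor_energy G n v = \<rho> 0 + (\<Sum>i\<in>{1..<n}. \<bar>\<rho> i\<bar>)"
    unfolding sombor_energy_def \<rho>_def[symmetric] split using \<rho>0 by simp
  have "\<rho> 0 = \<bar>\<Sum>i\<in>{1..<n}. \<rho> i\<bar>"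
    using sum split[of \<rho>] \<rho>0 by linarith
  then have lower: "2 * \<rho> 0 \<le> sombor_energy G n v"
    using sum_abs[of \<rho> "{1..<n}"] energy by linarith
  \<comment> \<open>Cauchy-Schwarz is applied against the constant 1, whose norm over the
    \<open>n - 1\<close> remaining indices is the second factor; \<open>n \<ge> 1\<close> makes the
    natural and real subtractions agree.\<close>
  have "(\<Sum>i\<in>{1..<n}. \<bar>\<rho> i\<bar>) \<le>
      sqrt (\<Sum>i\<in>{1..<n}. (\<rho> i)\<^sup>2) * sqrt (real n - 1)"
    using L2_set_mult_ineq[of \<rho> "\<lambda>_. 1" "{1..<n}"] assms(2) by (simp add: L2_set_def)
  also have "\<dots> = sqrt ((real n - 1) * (2 * F - (\<rho> 0)\<^sup>2))"
    using split[of "\<lambda>i. (\<rho> i)\<^sup>2"] sum_sq by (simp add: mult.commute flip: real_sqrt_mult)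
  finally have "(\<Sum>i\<in>{1..<n}. \<bar>\<rho> i\<bar>) \<le> sqrt ((real n - 1) * (2 * F - (\<rho> 0)\<^sup>2))" .
  then show ?thesis
    using lower energy by (simp add: Let_def \<rho>_def F_def)
qed

end
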